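(* Let $k\ge 0$ be an integer. There exists a dominant polynomial map $f:\mathbb{C}^2\to\mathbb{C}^2$ with $\mu_f=k+1$ and such that $\mathbb{C}^2\setminus f(\mathbb{C}^2)$ has at least one isolated point if and only if $k\ge 1$.
   Context: A polynomial map $f:\mathbb{C}^2\to\mathbb{C}^2$ is dominant if $f(\mathbb{C}^2)$ is dense in $\mathbb{C}^2$; $\mu_f$ denotes the number of preimages under $f$ of a generic point of $\mathbb{C}^2$. *)

theory Defs
  imports "HOL-Analysis.Analysis"
begin

definition poly2 :: "(complex \<times> complex \<Rightarrow> complex) \<Rightarrow> bool" where
  "poly2 P \<longleftrightarrow> (\<exists>(N::nat) (c::nat \<Rightarrow> nat \<Rightarrow> complex).
      \<forall>x y. P (x, y) = (\<Sum>i\<le>N. \<Sum>j\<le>N. c i j * x ^ i * y ^ j))"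

definition poly_map2 :: "(complex \<times> complex \<Rightarrow> complex \<times> complex) \<Rightarrow> bool" where
  "poly_map2 f \<longleftrightarrow> poly2 (\<lambda>z. fst (f z)) \<and> poly2 (\<lambda>z. snd (f z))"

definition dominant :: "(complex \<times> complex \<Rightarrow> complex \<times> complex) \<Rightarrow> bool" where
  "dominant f \<longleftrightarrow> closure (range f) = UNIV"

definition generic_fibre_card :: "(complex \<times> complex \<Rightarrow> complex \<times> complex) \<Rightarrow> nat \<Rightarrow> bool" where
  "generic_fibre_card f m \<longleftrightarrow> (\<exists>g. poly2 g \<and> (\<exists>z. g z \<noteq> 0) \<and>
      (\<forall>q. g q \<noteq> 0 \<longrightarrow> finite (f -` {q}) \<and> card (f -` {q}) = m))"

definition isolated_point_of :: "'a::metric_space \<Rightarrow> 'a set \<Rightarrow> bool" where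
  "isolated_point_of p S \<longleftrightarrow> p \<in> S \<and> (\<exists>e>0. ball p e \<inter> S = {p})"

end

theory Submission
  imports Defs
    "HOL-Complex_Analysis.Great_Picard"
    "HOL-Computational_Algebra.Field_as_Ring"
    "Jordan_Normal_Form.Char_Poly"
    "Subresultants.Subresultant_Gcd"
begin

text \<open>
  For \<open>k \<ge> 1\<close> the map \<open>(x, y) \<mapsto> (xy - 1, x + (xy - 1) y\<^sup>k)\<close> omits the origin but no other point
  near it: over \<open>(a, b)\<close> with \<open>a (1 + a) \<noteq> 0\<close> the fibre is given by \<open>x\<^sup>k (x - b) + a (1 + a)\<^sup>k = 0\<close>,
  which generically has \<open>k + 1\<close> roots, all nonzero, while \<open>(0, b)\<close> with \<open>b \<noteq> 0\<close> is the image of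
  \<open>(b, 1 / b)\<close>.

  For \<open>k = 0\<close> eliminate \<open>y\<close> from \<open>f(x, y) = q\<close> by a resultant. A suitable factor of this resultant
  has, for generic \<open>q\<close>, only one root, the first coordinate of the unique preimage of \<open>q\<close>; as the
  sum of the roots is rational in \<open>q\<close>, so is this coordinate, and by symmetry the other one.
  Write either as \<open>A / B\<close> in lowest terms and let \<open>p\<close> be an isolated point of the complement of the
  image. Near \<open>p\<close> every zero \<open>q = f(z) \<noteq> p\<close> of \<open>B\<close> is one of \<open>A\<close>, because \<open>A(f(z)) = x B(f(z))\<close>.
  The common zeros of \<open>A\<close> and \<open>B\<close> are finite in number, whereas by Hurwitz's theorem a zero of \<open>B\<close>
  is never isolated; hence \<open>B(p) \<noteq> 0\<close>. The inverse of \<open>f\<close> is thus continuous at \<open>p\<close>, and \<open>p\<close> is a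
  value of \<open>f\<close> after all.
\<close>

subsection \<open>Polynomial functions of two variables\<close>

lemma comm_ring_hom_eval_poly:
  assumes "comm_ring_hom h"
  shows "comm_ring_hom (\<lambda>P. poly (map_poly h P) x)"
proof -
  interpret h: comm_ring_hom h by fact
  interpret map_h: map_poly_comm_ring_hom h ..
  show ?thesis by unfold_locales (simp_all add: hom_distribs)
qed

definition slice :: "'a::comm_ring_1 \<Rightarrow> 'a poly poly \<Rightarrow> 'a poly" where
  "slice a F = map_poly (\<lambda>p. poly p a) F"

lemma coeff_slice: "coeff (slice a F) j = poly (coeff F j) a"
  by (simp add: slice_def)

definition bieval :: "'a::idom poly poly \<Rightarrow> 'a \<times> 'a \<Rightarrow> 'a" where
  "bieval F q = poly (slice (fst q) F) (snd q)"

interpretation bieval: idom_hom "\<lambda>F. bieval F q" for q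
  unfolding bieval_def slice_def
  by (intro idom_hom.intro comm_ring_hom_eval_poly poly_hom.comm_ring_hom_axioms)

lemma bieval_const: "bieval [:p:] q = poly p (fst q)"
  by (simp add: bieval_def slice_def poly_hom.map_poly_pCons_hom)

lemma bieval_monom [simp]: "bieval (monom (monom c i) j) q = c * fst q ^ i * snd q ^ j"
  by (simp add: bieval_def slice_def poly_monom)

lemma bieval_eq_double_sum:
  assumes "degree F \<le> N" "\<And>j. degree (coeff F j) \<le> N"
  shows "bieval F q = (\<Sum>i\<le>N. \<Sum>j\<le>N. coeff (coeff F j) i * fst q ^ i * snd q ^ j)"
proof -
  have "F = (\<Sum>j\<le>N. monom (\<Sum>i\<le>N. monom (coeff (coeff F j) i) i) j)"
    using assms by (simp add: poly_as_sum_of_monoms')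
  then have "bieval F q = bieval (\<Sum>i\<le>N. \<Sum>j\<le>N. monom (monom (coeff (coeff F j) i) i) j) q"
    by (subst sum.swap) (simp add: monom_sum)
  then show ?thesis by (simp add: bieval.hom_sum)
qed

lemma ex_bidegree_bound:
  fixes F :: "'a::zero poly poly"
  shows "\<exists>N. degree F \<le> N \<and> (\<forall>j. degree (coeff F j) \<le> N)"
proof (intro exI conjI allI)
  let ?N = "degree F + (\<Sum>j\<le>degree F. degree (coeff F j))"
  show "degree F \<le> ?N" by simp
  show "degree (coeff F j) \<le> ?N" for j
  proof (cases "j \<le> degree F")
    case True
    then have "degree (coeff F j) \<le> (\<Sum>j\<le>degree F. degree (coeff F j))"
      by (intro member_le_sum) auto
    then show ?thesis by simp
  qed (simp add: coeff_eq_0)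
qed

lemma poly2_iff_double_sum:
  "poly2 P \<longleftrightarrow> (\<exists>(N::nat) c. P = (\<lambda>q. \<Sum>i\<le>N. \<Sum>j\<le>N. c i j * fst q ^ i * snd q ^ j))"
  unfolding poly2_def fun_eq_iff split_paired_All by simp

lemma poly2_iff_bieval: "poly2 P \<longleftrightarrow> (\<exists>F. P = bieval F)"
proof
  assume "poly2 P"
  then obtain N :: nat and c where "P = (\<lambda>q. \<Sum>i\<le>N. \<Sum>j\<le>N. c i j * fst q ^ i * snd q ^ j)"
    unfolding poly2_iff_double_sum by blast
  then have "P = bieval (\<Sum>i\<le>N. \<Sum>j\<le>N. monom (monom (c i j) i) j)"
    by (simp add: fun_eq_iff bieval.hom_sum)
  then show "\<exists>F. P = bieval F" by blast
next
  assume "\<exists>F. P = bieval F"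
  then obtain F where F: "P = bieval F" by blast
  obtain N where "degree F \<le> N" "\<And>j. degree (coeff F j) \<le> N" using ex_bidegree_bound by blast
  then show "poly2 P" unfolding poly2_iff_double_sum F
    by (intro exI[of _ N] exI[of _ "\<lambda>i j. coeff (coeff F j) i"])
      (simp add: bieval_eq_double_sum fun_eq_iff)
qed

lemma poly2E:
  assumes "poly2 P"
  obtains F where "P = bieval F"
  using assms poly2_iff_bieval by blast

lemma poly_map2E:
  assumes "poly_map2 f"
  obtains F H where "\<And>z. f z = (bieval F z, bieval H z)"
proof -
  obtain F H where "(\<lambda>z. fst (f z)) = bieval F" "(\<lambda>z. snd (f z)) = bieval H"
    using assms unfolding poly_map2_def by (metis poly2E)
  then show thesis using that by (metis prod.collapse)
qed

lemma poly2_bieval: "poly2 (bieval F)"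
  unfolding poly2_iff_bieval by blast

named_theorems poly2_intros

lemma poly2_const [poly2_intros]: "poly2 (\<lambda>q. c)"
  unfolding poly2_iff_bieval by (intro exI[of _ "[:[:c:]:]"]) (simp add: bieval_const fun_eq_iff)

lemma poly2_fst [poly2_intros]: "poly2 fst"
  unfolding poly2_iff_bieval by (intro exI[of _ "[:[:0, 1:]:]"]) (simp add: bieval_const fun_eq_iff)

lemma poly2_snd [poly2_intros]: "poly2 snd"
  unfolding poly2_iff_bieval by (intro exI[of _ "[:0, 1:]"]) (simp add: bieval_def slice_def fun_eq_iff)

lemma poly2_add [poly2_intros]: "poly2 P \<Longrightarrow> poly2 Q \<Longrightarrow> poly2 (\<lambda>q. P q + Q q)"
  and poly2_diff [poly2_intros]: "poly2 P \<Longrightarrow> poly2 Q \<Longrightarrow> poly2 (\<lambda>q. P q - Q q)"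
  and poly2_mult [poly2_intros]: "poly2 P \<Longrightarrow> poly2 Q \<Longrightarrow> poly2 (\<lambda>q. P q * Q q)"
  unfolding poly2_iff_bieval
  by (auto simp: bieval.hom_add[symmetric] bieval.hom_minus[symmetric] bieval.hom_mult[symmetric])

lemma poly2_power [poly2_intros]: "poly2 P \<Longrightarrow> poly2 (\<lambda>q. P q ^ n)"
  by (induction n) (auto intro: poly2_intros)

lemma poly2_sum [poly2_intros]: "(\<And>i. i \<in> I \<Longrightarrow> poly2 (P i)) \<Longrightarrow> poly2 (\<lambda>q. \<Sum>i\<in>I. P i q)"
  by (induction I rule: infinite_finite_induct) (auto intro: poly2_intros)

lemma poly2_prod [poly2_intros]: "(\<And>i. i \<in> I \<Longrightarrow> poly2 (P i)) \<Longrightarrow> poly2 (\<lambda>q. \<Prod>i\<in>I. P i q)"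
  by (induction I rule: infinite_finite_induct) (auto intro: poly2_intros)

lemma poly2_poly [poly2_intros]: "poly2 P \<Longrightarrow> poly2 (\<lambda>q. poly p (P q))"
  unfolding poly_altdef by (intro poly2_intros)

lemma poly2_comp:
  assumes "poly2 P" "poly_map2 u"
  shows "poly2 (\<lambda>z. P (u z))"
proof -
  obtain N :: nat and c where "P = (\<lambda>q. \<Sum>i\<le>N. \<Sum>j\<le>N. c i j * fst q ^ i * snd q ^ j)"
    using assms(1) unfolding poly2_iff_double_sum by blast
  moreover have "poly2 (\<lambda>z. fst (u z))" "poly2 (\<lambda>z. snd (u z))"
    using assms(2) by (simp_all add: poly_map2_def)
  ultimately show ?thesis by (simp only:) (intro poly2_intros)
qed

lemma poly_map2_id: "poly_map2 (\<lambda>q. q)"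
  by (simp add: poly_map2_def poly2_fst poly2_snd)

lemma poly_map2_comp: "poly_map2 f \<Longrightarrow> poly_map2 u \<Longrightarrow> poly_map2 (f \<circ> u)"
  unfolding poly_map2_def o_def by (auto intro: poly2_comp simp: poly_map2_def)

lemma continuous_on_poly2: "poly2 P \<Longrightarrow> continuous_on S P"
  unfolding poly2_iff_double_sum by (auto intro!: continuous_intros)

lemma isCont_poly2: "poly2 P \<Longrightarrow> isCont P q"
  using continuous_on_poly2[of P UNIV] unfolding continuous_on_eq_continuous_at[OF open_UNIV] by blast

lemma isCont_poly_map2:
  assumes "poly_map2 f"
  shows "isCont f q"
proof -
  have "isCont (\<lambda>z. (fst (f z), snd (f z))) q"
    using assms unfolding poly_map2_def by (intro continuous_Pair isCont_poly2) auto
  then show ?thesis by simp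
qed

lemma slice_eq_0_of_infinite_zeros:
  assumes "infinite {b. bieval F (a, b) = 0}"
  shows "slice a F = 0"
  using assms poly_roots_finite unfolding bieval_def fst_conv snd_conv by blast

lemma bieval_eq_0_on_infinite_product:
  assumes "infinite S" "infinite T" "\<And>a b. a \<in> S \<Longrightarrow> b \<in> T \<Longrightarrow> bieval F (a, b) = 0"
  shows "F = 0"
proof -
  have vanish: "slice a F = 0" if "a \<in> S" for a
  proof (rule slice_eq_0_of_infinite_zeros)
    have "T \<subseteq> {b. bieval F (a, b) = 0}" using assms(3) that by auto
    then show "infinite {b. bieval F (a, b) = 0}" using assms(2) by (rule infinite_super)
  qed
  have "coeff F j = 0" for j
  proof (rule ccontr)
    assume "coeff F j \<noteq> 0"
    then have "finite {a. poly (coeff F j) a = 0}" by (rule poly_roots_finite)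
    moreover have "S \<subseteq> {a. poly (coeff F j) a = 0}"
      using vanish by (auto simp flip: coeff_slice)
    ultimately show False using assms(1) finite_subset by blast
  qed
  then show ?thesis by (simp add: poly_eq_iff)
qed

lemma bieval_eq_0_iff: "(\<forall>q. bieval F q = 0) \<longleftrightarrow> F = 0" for F :: "complex poly poly"
  using bieval_eq_0_on_infinite_product[of UNIV UNIV F] by (auto simp: infinite_UNIV_char_0)

lemma poly2_mult_eq_0_cancel:
  assumes "poly2 P" "poly2 Q" "\<exists>q. P q \<noteq> 0" "\<And>q. P q * Q q = 0"
  shows "Q q = 0"
proof -
  obtain F H where FH: "P = bieval F" "Q = bieval H"
    using assms(1,2) by (metis poly2E)
  then have "F * H = 0"
    using assms(4) by (simp add: bieval.hom_mult flip: bieval_eq_0_iff)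
  moreover have "F \<noteq> 0" using assms(3) by (auto simp: FH)
  ultimately show ?thesis by (simp add: FH)
qed

lemma poly2_mult_left_cancel:
  assumes "poly2 P" "poly2 Q" "poly2 R" "\<exists>q. P q \<noteq> 0" "\<And>q. P q * Q q = P q * R q"
  shows "Q q = R q"
proof -
  have "P q * (Q q - R q) = 0" for q using assms(5)[of q] by (simp add: right_diff_distrib)
  then have "Q q - R q = 0"
    using assms(1-4) by (intro poly2_mult_eq_0_cancel[of P "\<lambda>q. Q q - R q"] poly2_diff)
  then show ?thesis by simp
qed

lemma poly2_mult_nonzero:
  assumes "poly2 P" "poly2 Q" "\<exists>q. P q \<noteq> 0" "\<exists>q. Q q \<noteq> 0"
  shows "\<exists>q. P q * Q q \<noteq> 0"
  using poly2_mult_eq_0_cancel[OF assms(1-3)] assms(4) by blast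

lemma poly2_prod_nonzero:
  assumes "finite I" "\<And>i. i \<in> I \<Longrightarrow> poly2 (P i)" "\<And>i. i \<in> I \<Longrightarrow> \<exists>q. P i q \<noteq> 0"
  shows "\<exists>q. (\<Prod>i\<in>I. P i q) \<noteq> 0"
  using assms
proof (induction I rule: finite_induct)
  case (insert i I)
  then have "\<exists>q. P i q * (\<Prod>i\<in>I. P i q) \<noteq> 0"
    by (intro poly2_mult_nonzero poly2_prod) auto
  then show ?case using insert.hyps by simp
qed simp

lemma dist_le_dist_fst_plus_dist_snd: "dist p q \<le> dist (fst p) (fst q) + dist (snd p) (snd q)"
  unfolding dist_prod_def by (simp add: sqrt_sum_squares_le_sum)

lemma poly2_nonzero_dense:
  assumes "poly2 P" "\<exists>q. P q \<noteq> 0"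
  shows "closure {q. P q \<noteq> 0} = UNIV"
proof -
  obtain F where F: "P = bieval F" using assms(1) by (rule poly2E)
  then have "F \<noteq> 0" using assms(2) by auto
  have "\<exists>q\<in>{q. P q \<noteq> 0}. dist q p < e" if "e > 0" for p e
  proof (rule ccontr)
    assume no_nonzero: "\<not> ?thesis"
    have "bieval F (x, y) = 0" if xy: "x \<in> ball (fst p) (e/2)" "y \<in> ball (snd p) (e/2)" for x y
    proof -
      have "dist (x, y) p < e"
        using dist_le_dist_fst_plus_dist_snd[of "(x, y)" p] xy by (simp add: dist_commute)
      then show ?thesis using no_nonzero F by auto
    qed
    moreover have "infinite (ball a (e/2))" for a :: complex
      using that by (intro uncountable_infinite uncountable_ball) simp
    ultimately show False
      using bieval_eq_0_on_infinite_product \<open>F \<noteq> 0\<close> by blast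
  qed
  then show ?thesis by (auto simp: closure_approachable)
qed

lemma poly2_eq_0_on_range:
  assumes "poly2 P" "dominant f" "\<And>z. P (f z) = 0"
  shows "P q = 0"
proof -
  have "closed {q. P q = 0}"
    by (intro closed_Collect_eq continuous_on_poly2 assms(1) continuous_on_const)
  moreover have "range f \<subseteq> {q. P q = 0}" using assms(3) by auto
  ultimately have "closure (range f) \<subseteq> {q. P q = 0}" by (intro closure_minimal)
  then show ?thesis using assms(2) unfolding dominant_def by blast
qed

subsection \<open>Generic fibres\<close>

lemma generic_fibre_card_imp_dominant:
  assumes "generic_fibre_card f m" "m > 0"
  shows "dominant f"
proof -
  obtain g where g: "poly2 g" "\<exists>q. g q \<noteq> 0" "\<And>q. g q \<noteq> 0 \<Longrightarrow> card (f -` {q}) = m"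
    using assms(1) unfolding generic_fibre_card_def by blast
  have "{q. g q \<noteq> 0} \<subseteq> range f"
  proof
    fix q assume "q \<in> {q. g q \<noteq> 0}"
    then have "f -` {q} \<noteq> {}" using g(3) assms(2) by fastforce
    then show "q \<in> range f" by blast
  qed
  then have "closure {q. g q \<noteq> 0} \<subseteq> closure (range f)" by (rule closure_mono)
  then show ?thesis using poly2_nonzero_dense[OF g(1,2)] by (auto simp: dominant_def)
qed

lemma generic_fibre_card_comp_bij:
  assumes "generic_fibre_card f m" "bij \<sigma>"
  shows "generic_fibre_card (f \<circ> \<sigma>) m"
  using assms unfolding generic_fibre_card_def vimage_comp[symmetric]
  by (auto simp: finite_vimage_iff card_vimage_inj bij_is_inj bij_is_surj)

subsection \<open>Eliminants\<close>

lemma poly_gcd_eq_0_iff: "poly (gcd p q) x = 0 \<longleftrightarrow> poly p x = 0 \<and> poly q x = 0"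
  for p q :: "'a::field_gcd poly"
  by (simp add: poly_eq_0_iff_dvd)

lemma resultant_eq_0_iff_common_root:
  fixes p q :: "complex poly"
  assumes "p \<noteq> 0"
  shows "resultant p q = 0 \<longleftrightarrow> (\<exists>t. poly p t = 0 \<and> poly q t = 0)"
proof -
  have "degree (gcd p q) = 0 \<longleftrightarrow> (\<forall>t. poly (gcd p q) t \<noteq> 0)"
  proof
    assume "degree (gcd p q) = 0"
    then obtain c where "gcd p q = [:c:]" by (rule degree_eq_zeroE)
    then show "\<forall>t. poly (gcd p q) t \<noteq> 0" using assms by auto
  next
    assume "\<forall>t. poly (gcd p q) t \<noteq> 0"
    then show "degree (gcd p q) = 0"
      using fundamental_theorem_of_algebra[of "gcd p q"] unfolding constant_degree by blast
  qed
  then show ?thesis by (simp add: resultant_0_gcd poly_gcd_eq_0_iff)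
qed

text \<open>Adding to \<open>Q\<close> the product of \<open>P\<close> with a high power of the variable gives both arguments the same
  leading coefficient, so that the resultant commutes with every specialization that preserves the
  degree of \<open>P\<close> alone.\<close>

definition eliminant :: "'a::comm_ring_1 poly \<Rightarrow> 'a poly \<Rightarrow> 'a" where
  "eliminant P Q = resultant P (Q + monom 1 (Suc (degree Q)) * P)"

lemma eliminant_eq_0_iff:
  fixes P Q :: "'a::{factorial_ring_gcd,semiring_gcd_mult_normalize} poly"
  shows "eliminant P Q = 0 \<longleftrightarrow> degree (gcd P Q) \<noteq> 0"
  unfolding eliminant_def resultant_0_gcd using gcd_add_mult[of P _ Q] by (simp add: add.commute)

lemma eliminant_eq_0_iff_common_root:
  fixes P Q :: "'a::idom poly" and h :: "'a \<Rightarrow> complex"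
  assumes "comm_ring_hom h" "h (lead_coeff P) \<noteq> 0"
  shows "h (eliminant P Q) = 0 \<longleftrightarrow> (\<exists>t. poly (map_poly h P) t = 0 \<and> poly (map_poly h Q) t = 0)"
proof -
  interpret h: comm_ring_hom h by fact
  interpret map_h: map_poly_comm_ring_hom h ..
  define k where "k = Suc (degree Q)"
  have "P \<noteq> 0" using assms(2) by auto
  then have deg_mult: "degree (monom 1 k * P) = k + degree P"
    by (simp add: degree_mult_eq degree_monom_eq)
  then have degree_sum: "degree (Q + monom 1 k * P) = k + degree P"
    by (subst degree_add_eq_right) (simp_all add: k_def)
  have lead_coeff_sum: "coeff (Q + monom 1 k * P) (k + degree P) = lead_coeff P"
    by (simp add: coeff_monom_mult coeff_eq_0 k_def)
  have "degree (map_poly h P) = degree P"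
    using assms(2) by (intro degree_map_poly) auto
  moreover have "degree (map_poly h (Q + monom 1 k * P)) = degree (Q + monom 1 k * P)"
    using assms(2) by (intro degree_map_poly) (metis degree_sum lead_coeff_sum coeff_0 h.hom_zero)
  ultimately have "h (eliminant P Q) = resultant (map_poly h P) (map_poly h (Q + monom 1 k * P))"
    unfolding eliminant_def k_def[symmetric] by (simp add: h.resultant_map_poly)
  moreover have "map_poly h P \<noteq> 0" using assms(2) by (metis h.coeff_map_poly_hom coeff_0)
  ultimately show ?thesis
    by (auto simp: resultant_eq_0_iff_common_root hom_distribs)
qed

definition specialize :: "complex \<times> complex \<Rightarrow> complex poly poly poly \<Rightarrow> complex poly" where
  "specialize q = map_poly (\<lambda>c. bieval c q)"

interpretation specialize: comm_ring_hom "specialize q" for q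
proof -
  interpret map_poly_comm_ring_hom "\<lambda>c. bieval c q" ..
  show "comm_ring_hom (specialize q)" unfolding specialize_def by (rule comm_ring_hom_axioms)
qed

lemma coeff_specialize: "coeff (specialize q P) i = bieval (coeff P i) q"
  by (simp add: specialize_def)

lemma poly_specialize: "poly (specialize q P) s = bieval (poly P [:[:s:]:]) q"
  unfolding specialize_def using bieval.poly_map_poly[of q P "[:[:s:]:]"]
  by (simp add: bieval_const)

lemma poly_specialize_const: "poly (specialize q [:c:]) s = bieval c q"
  by (simp add: poly_specialize)

lemma comm_ring_hom_poly_specialize: "comm_ring_hom (\<lambda>P. poly (specialize q P) s)"
  unfolding specialize_def by (intro comm_ring_hom_eval_poly bieval.comm_ring_hom_axioms)

lemma poly2_poly_specialize [poly2_intros]: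
  assumes "poly_map2 u" "poly2 X"
  shows "poly2 (\<lambda>z. poly (specialize (u z) P) (X z))"
proof (induction P)
  case 0
  show ?case by (simp add: poly2_const)
next
  case (pCons c P)
  have "poly (specialize (u z) (pCons c P)) (X z)
      = bieval c (u z) + X z * poly (specialize (u z) P) (X z)" for z
    by (simp add: specialize_def bieval.map_poly_pCons_hom)
  then show ?case
    by (simp only:) (intro poly2_intros poly2_comp[OF poly2_bieval] assms pCons.IH)
qed

subsection \<open>The eliminant of a fibre\<close>

definition lift_coeffs :: "complex poly poly \<Rightarrow> complex poly poly poly poly" where
  "lift_coeffs = map_poly (map_poly (\<lambda>c. [:[:c:]:]))"

lemma coeff_lift_coeffs:
  "coeff (lift_coeffs G) i = map_poly (\<lambda>c. [:[:c:]:]) (coeff G i)"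
  by (simp add: lift_coeffs_def coeff_map_poly)

lemma poly_specialize_map_poly_const:
  "poly (specialize q (map_poly (\<lambda>c. [:[:c:]:]) p)) s = poly p s"
  by (simp add: specialize_def map_poly_map_poly o_def bieval_const)

text \<open>Eliminates \<open>t\<close> from the equations \<open>G\<^sub>1(s, t) = w\<^sub>1(q)\<close> and \<open>G\<^sub>2(s, t) = w\<^sub>2(q)\<close>, where \<open>t\<close> is
  the outermost variable, \<open>s\<close> the next one, and \<open>q\<close> comprises the two innermost ones.\<close>

definition fibre_eliminant ::
  "complex poly poly \<Rightarrow> complex poly poly \<Rightarrow> complex poly poly \<Rightarrow> complex poly poly \<Rightarrow>
    complex poly poly poly" where
  "fibre_eliminant G1 w1 G2 w2 =
    eliminant (lift_coeffs G1 - [:[:w1:]:]) (lift_coeffs G2 - [:[:w2:]:])"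

lemma fibre_eliminant_eq_0_iff:
  assumes "degree G1 > 0" "poly (lead_coeff G1) s \<noteq> 0"
  shows "poly (specialize q (fibre_eliminant G1 w1 G2 w2)) s = 0 \<longleftrightarrow>
    (\<exists>t. bieval G1 (s, t) = bieval w1 q \<and> bieval G2 (s, t) = bieval w2 q)"
proof -
  let ?h = "\<lambda>P. poly (specialize q P) s"
  interpret h: comm_ring_hom ?h by (rule comm_ring_hom_poly_specialize)
  interpret map_h: map_poly_comm_ring_hom ?h ..
  have eval: "poly (map_poly ?h (lift_coeffs G - [:[:w:]:])) t = bieval G (s, t) - bieval w q" for G w t
  proof -
    have "map_poly ?h (lift_coeffs G) = slice s G"
      by (intro poly_eqI) (simp add: coeff_slice coeff_lift_coeffs poly_specialize_map_poly_const)
    moreover have "map_poly ?h [:[:w:]:] = [:bieval w q:]"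
      by (simp add: h.map_poly_pCons_hom poly_specialize_const)
    ultimately show ?thesis by (simp add: hom_distribs bieval_def)
  qed
  have "degree (lift_coeffs G1) = degree G1"
    unfolding lift_coeffs_def by (intro degree_map_poly) (simp add: map_poly_eq_0_iff)
  then have "degree (lift_coeffs G1 - [:[:w1:]:]) = degree G1"
    using assms(1) degree_add_eq_left[of "- [:[:w1:]:]" "lift_coeffs G1"]
    by (simp del: minus_pCons)
  moreover have "coeff (lift_coeffs G1 - [:[:w1:]:]) (degree G1)
      = map_poly (\<lambda>c. [:[:c:]:]) (lead_coeff G1)"
    using assms(1) by (simp add: coeff_lift_coeffs coeff_eq_0)
  ultimately have "?h (lead_coeff (lift_coeffs G1 - [:[:w1:]:])) \<noteq> 0"
    using assms(2) by (simp add: poly_specialize_map_poly_const)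
  then show ?thesis
    unfolding fibre_eliminant_def
    by (simp add: eliminant_eq_0_iff_common_root[OF h.comm_ring_hom_axioms] eval)
qed

lemma ex_fibre_eliminant:
  assumes "poly_map2 f" "f (x, y) \<noteq> f (x, y')"
  obtains E \<alpha> where "\<alpha> \<noteq> 0"
    "\<And>q s. poly \<alpha> s \<noteq> 0 \<Longrightarrow> poly (specialize q E) s = 0 \<longleftrightarrow> (\<exists>t. f (s, t) = q)"
proof -
  obtain F H where f: "\<And>z. f z = (bieval F z, bieval H z)" using poly_map2E[OF assms(1)] by blast
  define u v :: "complex poly poly" where "u = [:[:0, 1:]:]" and "v = [:0, 1:]"
  have uv: "bieval u q = fst q" "bieval v q = snd q" for q
    by (simp_all add: u_def v_def bieval_const) (simp add: bieval_def slice_def)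
  have "degree F > 0 \<or> degree H > 0"
  proof (rule ccontr)
    assume "\<not> ?thesis"
    then obtain a b where "F = [:a:]" "H = [:b:]" by (auto elim!: degree_eq_zeroE)
    then show False using assms(2) by (simp add: f bieval_const)
  qed
  then show thesis
  proof
    assume deg: "degree F > 0"
    then have "lead_coeff F \<noteq> 0" by auto
    then show thesis
      using deg that[of "lead_coeff F" "fibre_eliminant F u H v"]
      by (auto simp: fibre_eliminant_eq_0_iff f uv prod_eq_iff)
  next
    assume deg: "degree H > 0"
    then have "lead_coeff H \<noteq> 0" by auto
    then show thesis
      using deg that[of "lead_coeff H" "fibre_eliminant H v F u"]
      by (auto simp: fibre_eliminant_eq_0_iff f uv prod_eq_iff)
  qed
qed

subsection \<open>Rationality of the inverse of a generically injective map\<close>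

lemma generic_fibre_card_1_inj_onE:
  assumes "generic_fibre_card f 1"
  obtains g where "poly2 g" "\<exists>q. g q \<noteq> 0" "inj_on f {z. g (f z) \<noteq> 0}"
proof -
  obtain g where g: "poly2 g" "\<exists>q. g q \<noteq> 0" "\<And>q. g q \<noteq> 0 \<Longrightarrow> card (f -` {q}) = 1"
    using assms unfolding generic_fibre_card_def by blast
  have "inj_on f {z. g (f z) \<noteq> 0}"
  proof (rule inj_onI)
    fix z w assume "z \<in> {z. g (f z) \<noteq> 0}" and eq: "f z = f w"
    then obtain z' where "f -` {f z} = {z'}" using g(3)[of "f z"] by (auto simp: card_1_singleton_iff)
    then have "z \<in> {z'}" "w \<in> {z'}" using eq by auto
    then show "z = w" by simp
  qed
  then show thesis using that g(1,2) by blast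
qed

lemma generically_injective_imp_ex_relation:
  assumes f: "poly_map2 f" and inj: "inj_on f {z. g (f z) \<noteq> 0}" and "\<exists>z. g (f z) \<noteq> 0"
  obtains E \<alpha> where "E \<noteq> 0" "\<alpha> \<noteq> 0" "\<And>z. poly (specialize (f z) E) (fst z) = 0"
    "\<And>z s. g (f z) \<noteq> 0 \<Longrightarrow> poly \<alpha> s \<noteq> 0 \<Longrightarrow> poly (specialize (f z) E) s = 0 \<Longrightarrow> s = fst z"
proof -
  have unique: "w = z" if "g (f z) \<noteq> 0" "f w = f z" for z w
    using inj_onD[OF inj that(2)] that by simp
  obtain z0 where z0: "g (f z0) \<noteq> 0" using assms(3) by blast
  have "f (fst z0, snd z0) \<noteq> f (fst z0, snd z0 + 1)"
    using unique[OF z0, of "(fst z0, snd z0 + 1)"] by (auto simp: prod_eq_iff)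
  then obtain E \<alpha> where \<alpha>: "\<alpha> \<noteq> 0"
    and E: "\<And>q s. poly \<alpha> s \<noteq> 0 \<Longrightarrow> poly (specialize q E) s = 0 \<longleftrightarrow> (\<exists>t. f (s, t) = q)"
    by (rule ex_fibre_eliminant[OF f]) blast
  have root: "s = fst z" if "g (f z) \<noteq> 0" "poly \<alpha> s \<noteq> 0" "poly (specialize (f z) E) s = 0" for z s
    using E[OF that(2), of "f z"] that(3) unique[OF that(1)] by (metis fst_conv)
  have finite_roots: "finite {s. poly \<alpha> s = 0}" using \<alpha> by (rule poly_roots_finite)
  have "E \<noteq> 0"
  proof
    assume "E = 0"
    then have "s \<in> insert (fst z0) {s. poly \<alpha> s = 0}" for s using root[OF z0, of s] by auto
    then have "(UNIV :: complex set) = insert (fst z0) {s. poly \<alpha> s = 0}" by blast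
    then show False using finite_roots infinite_UNIV_char_0 by (metis finite_insert)
  qed
  moreover have "poly (specialize (f z) E) (fst z) = 0" for z
  proof (rule poly2_mult_eq_0_cancel)
    obtain s where "poly \<alpha> s \<noteq> 0" using \<alpha> poly_all_0_iff_0 by blast
    then show "\<exists>z. poly \<alpha> (fst z) \<noteq> 0" by (metis fst_conv)
    show "poly \<alpha> (fst z) * poly (specialize (f z) E) (fst z) = 0" for z
      using E[of "fst z" "f z"] by (metis mult_eq_0_iff prod.collapse)
  qed (intro poly2_intros f)+
  ultimately show thesis using that \<alpha> root by blast
qed

text \<open>The extraneous roots of an eliminant do not depend on \<open>q\<close>. A factor \<open>P\<close> of least degree that still
  vanishes has no constant root \<open>s\<close>, since otherwise the cofactor of \<open>X - s\<close> would vanish as well.\<close>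

lemma ex_vanishing_factor_without_constant_root:
  assumes "poly_map2 f" "poly2 X" "\<And>s. \<exists>z. X z \<noteq> s"
    and E: "E \<noteq> 0" "\<And>z. poly (specialize (f z) E) (X z) = 0"
  obtains P where "P dvd E" "\<And>z. poly (specialize (f z) P) (X z) = 0"
    "\<And>s. \<exists>q. poly (specialize q P) s \<noteq> 0"
proof -
  define vanishing where
    "vanishing P \<longleftrightarrow> P dvd E \<and> (\<forall>z. poly (specialize (f z) P) (X z) = 0)" for P
  have "vanishing E" using E(2) by (simp add: vanishing_def)
  then obtain P where P: "vanishing P" and least: "\<And>R. vanishing R \<Longrightarrow> degree P \<le> degree R"
    using ex_has_least_nat[of vanishing E degree] by blast
  have "\<exists>q. poly (specialize q P) s \<noteq> 0" for s
  proof (rule ccontr)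
    assume "\<not> ?thesis"
    then have "poly P [:[:s:]:] = 0" by (simp add: poly_specialize flip: bieval_eq_0_iff)
    then obtain R where R: "P = [:- [:[:s:]:], 1:] * R" by (metis poly_eq_0_iff_dvd dvdE)
    have eval: "poly (specialize (f z) P) (X z) = (X z - s) * poly (specialize (f z) R) (X z)" for z
      unfolding R specialize.hom_mult by (simp add: poly_specialize bieval_const)
    have "poly (specialize (f z) R) (X z) = 0" for z
    proof (rule poly2_mult_eq_0_cancel[of "\<lambda>z. X z - s"])
      show "(X z - s) * poly (specialize (f z) R) (X z) = 0" for z
        using P eval[of z] unfolding vanishing_def by metis
    qed (use assms(3)[of s] in \<open>auto intro!: poly2_intros assms(1,2)\<close>)
    then have "vanishing R" using P R unfolding vanishing_def by (metis dvd_mult_right)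
    moreover have "R \<noteq> 0" using P E(1) R by (auto simp: vanishing_def)
    then have "degree P = Suc (degree R)" unfolding R by (subst degree_mult_eq) auto
    ultimately show False using least[of R] by simp
  qed
  then show thesis using that P unfolding vanishing_def by blast
qed

lemma coeff_pred_degree_of_single_root:
  fixes p :: "complex poly"
  assumes "degree p > 0" "\<And>s. poly p s = 0 \<Longrightarrow> s = x"
  shows "coeff p (degree p - 1) = - of_nat (degree p) * lead_coeff p * x"
proof -
  define n where "n = order x p"
  obtain s where "poly p s = 0"
    using assms(1) fundamental_theorem_of_algebra[of p] unfolding constant_degree by blast
  then have "{s. poly p s = 0} = {x}" using assms(2) by blast
  then have p: "p = Polynomial.smult (lead_coeff p) ([:- x, 1:] ^ n)"
    using complex_poly_decompose[of p] by (simp add: n_def)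
  have "degree (Polynomial.smult (lead_coeff p) ([:- x, 1:] ^ n)) = n"
    using assms(1) degree_linear_power[of "- x" n] by auto
  then have n: "degree p = n" using p by metis
  then obtain m where m: "n = Suc m" using assms(1) by (cases n) auto
  then have "coeff ([:- x, 1:] ^ n) m = - of_nat n * x"
    using coeff_linear_poly_power[of m n "- x" 1] by (simp add: algebra_simps)
  then have "coeff (Polynomial.smult (lead_coeff p) ([:- x, 1:] ^ n)) m = - of_nat n * lead_coeff p * x"
    by simp
  then show ?thesis using arg_cong[OF p, of "\<lambda>r. coeff r m"] by (simp only: n m diff_Suc_1)
qed

lemma degree_pos_of_vanishing:
  assumes "dominant f" "P \<noteq> 0" "\<And>z. poly (specialize (f z) P) (X z) = 0"
  shows "degree P > 0"
proof (rule ccontr)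
  assume "\<not> ?thesis"
  then obtain c where c: "P = [:c:]" by (auto elim: degree_eq_zeroE)
  then have "bieval c (f z) = 0" for z using assms(3)[of z] by (simp add: poly_specialize_const)
  then have "bieval c q = 0" for q by (rule poly2_eq_0_on_range[OF poly2_bieval assms(1)])
  then show False using assms(2) c bieval_eq_0_iff[of c] by simp
qed

lemma generically_injective_imp_ex_single_root_relation:
  assumes f: "poly_map2 f" "generic_fibre_card f 1"
  obtains P G where "poly2 G" "\<exists>z. G (f z) \<noteq> 0" "degree P > 0"
    "\<And>q. G q \<noteq> 0 \<Longrightarrow> bieval (lead_coeff P) q \<noteq> 0"
    "\<And>z s. G (f z) \<noteq> 0 \<Longrightarrow> poly (specialize (f z) P) s = 0 \<Longrightarrow> s = fst z"
proof -
  have dom: "dominant f" using f(2) by (rule generic_fibre_card_imp_dominant) simp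
  obtain g where g: "poly2 g" "\<exists>q. g q \<noteq> 0" "inj_on f {z. g (f z) \<noteq> 0}"
    using f(2) by (rule generic_fibre_card_1_inj_onE)
  have "\<exists>z. g (f z) \<noteq> 0" using poly2_eq_0_on_range[OF g(1) dom] g(2) by blast
  then obtain E \<alpha> where E: "E \<noteq> 0" "\<alpha> \<noteq> 0" "\<And>z. poly (specialize (f z) E) (fst z) = 0"
    and root: "\<And>z s. g (f z) \<noteq> 0 \<Longrightarrow> poly \<alpha> s \<noteq> 0 \<Longrightarrow> poly (specialize (f z) E) s = 0 \<Longrightarrow> s = fst z"
    by (rule generically_injective_imp_ex_relation[OF f(1) g(3)]) (rule that)
  have "\<exists>z :: complex \<times> complex. fst z \<noteq> s" for s by (rule exI[of _ "(s + 1, 0)"]) simp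
  then obtain P where P: "P dvd E" "\<And>z. poly (specialize (f z) P) (fst z) = 0"
    and no_constant_root: "\<And>s. \<exists>q. poly (specialize q P) s \<noteq> 0"
    using ex_vanishing_factor_without_constant_root[OF f(1) poly2_fst _ E(1,3)] by metis
  have "P \<noteq> 0" using no_constant_root[of 0] by auto
  have "degree P > 0" by (rule degree_pos_of_vanishing[OF dom \<open>P \<noteq> 0\<close> P(2)])
  define G where
    "G q = g q * (bieval (lead_coeff P) q * (\<Prod>s | poly \<alpha> s = 0. poly (specialize q P) s))" for q
  have "poly2 G" unfolding G_def by (intro poly2_intros g(1) poly2_bieval poly_map2_id)
  moreover have "\<exists>q. G q \<noteq> 0" unfolding G_def
  proof (intro poly2_mult_nonzero poly2_prod_nonzero poly2_intros poly2_bieval poly_map2_id g(1,2))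
    show "\<exists>q. bieval (lead_coeff P) q \<noteq> 0"
      using \<open>P \<noteq> 0\<close> bieval_eq_0_iff[of "lead_coeff P"] by auto
  qed (use E(2) poly_roots_finite no_constant_root in auto)
  then have "\<exists>z. G (f z) \<noteq> 0" using poly2_eq_0_on_range[OF \<open>poly2 G\<close> dom] by blast
  moreover have "s = fst z" if "G (f z) \<noteq> 0" "poly (specialize (f z) P) s = 0" for z s
  proof (rule root)
    have "finite {s. poly \<alpha> s = 0}" using E(2) by (rule poly_roots_finite)
    then show "poly \<alpha> s \<noteq> 0" using that by (auto simp: G_def prod_zero_iff)
    show "poly (specialize (f z) E) s = 0"
      using P(1) that(2) by (auto elim!: dvdE simp: specialize.hom_mult)
  qed (use that in \<open>simp add: G_def\<close>)
  ultimately show thesis using that[of G P] \<open>degree P > 0\<close> by (simp add: G_def)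
qed

lemma generically_injective_imp_fst_rational:
  assumes f: "poly_map2 f" "generic_fibre_card f 1"
  shows "\<exists>A B. B \<noteq> 0 \<and> (\<forall>z. bieval A (f z) = fst z * bieval B (f z))"
proof -
  obtain P G where G: "poly2 G" "\<exists>z. G (f z) \<noteq> 0" and P: "degree P > 0"
    "\<And>q. G q \<noteq> 0 \<Longrightarrow> bieval (lead_coeff P) q \<noteq> 0"
    "\<And>z s. G (f z) \<noteq> 0 \<Longrightarrow> poly (specialize (f z) P) s = 0 \<Longrightarrow> s = fst z"
    by (rule generically_injective_imp_ex_single_root_relation[OF f]) blast
  define A where "A = - coeff P (degree P - 1)"
  define B where "B = of_nat (degree P) * lead_coeff P"
  have generic: "bieval A (f z) = fst z * bieval B (f z)" if nz: "G (f z) \<noteq> 0" for z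
  proof -
    have "degree (specialize (f z) P) = degree P"
      using P(2)[OF nz] unfolding specialize_def by (intro degree_map_poly) auto
    then have "coeff (specialize (f z) P) (degree P - 1)
        = - of_nat (degree P) * coeff (specialize (f z) P) (degree P) * fst z"
      using coeff_pred_degree_of_single_root[of "specialize (f z) P" "fst z"] P(1) P(3)[OF nz] by simp
    then show ?thesis
      by (simp add: A_def B_def coeff_specialize bieval.hom_uminus bieval.hom_mult bieval.hom_of_nat)
  qed
  have "bieval A (f z) = fst z * bieval B (f z)" for z
  proof (rule poly2_mult_left_cancel[of "\<lambda>z. G (f z)" "\<lambda>z. bieval A (f z)"])
    show "G (f z) * bieval A (f z) = G (f z) * (fst z * bieval B (f z))" for z
      using generic[of z] by (cases "G (f z) = 0") simp_all
  qed (intro G(2) poly2_intros poly2_comp[OF G(1)] poly2_comp[OF poly2_bieval] f(1))+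
  moreover have "B \<noteq> 0" using P(1) by (auto simp: B_def)
  ultimately show ?thesis by blast
qed

lemma ex_reduced_fraction:
  assumes f: "poly_map2 f" "dominant f" and X: "poly2 X"
    and "B \<noteq> 0" "\<And>z. bieval A (f z) = X z * bieval B (f z)"
  shows "\<exists>A B. coprime A B \<and> (\<forall>z. bieval A (f z) = X z * bieval B (f z))"
proof -
  define D where "D = gcd A B"
  have "D \<noteq> 0" using assms(4) by (simp add: D_def)
  obtain A' B' where reduced: "A = A' * D" "B = B' * D" "coprime A' B'"
    using gcd_coprime_exists[of A B] \<open>D \<noteq> 0\<close> unfolding D_def by blast
  have nonzero: "\<exists>z. bieval D (f z) \<noteq> 0"
    using poly2_eq_0_on_range[OF poly2_bieval f(2)] \<open>D \<noteq> 0\<close> bieval_eq_0_iff[of D] by blast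
  have "bieval A' (f z) = X z * bieval B' (f z)" for z
  proof (rule poly2_mult_left_cancel[of "\<lambda>z. bieval D (f z)" "\<lambda>z. bieval A' (f z)"])
    show "bieval D (f z) * bieval A' (f z) = bieval D (f z) * (X z * bieval B' (f z))" for z
      using assms(5)[of z] by (simp add: reduced(1,2) bieval.hom_mult mult_ac)
  qed (intro nonzero poly2_intros poly2_comp[OF poly2_bieval] f(1) X)+
  then show ?thesis using reduced(3) by blast
qed

lemma generically_injective_imp_fst_reduced_fraction:
  assumes f: "poly_map2 f" "generic_fibre_card f 1"
  shows "\<exists>A B. coprime A B \<and> (\<forall>z. bieval A (f z) = fst z * bieval B (f z))"
proof -
  have "dominant f" using f(2) by (rule generic_fibre_card_imp_dominant) simp
  then show ?thesis
    using generically_injective_imp_fst_rational[OF f] ex_reduced_fraction[OF f(1) _ poly2_fst] by blast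
qed

lemma generically_injective_imp_snd_reduced_fraction:
  assumes f: "poly_map2 f" "generic_fibre_card f 1"
  shows "\<exists>A B. coprime A B \<and> (\<forall>z. bieval A (f z) = snd z * bieval B (f z))"
proof -
  have "poly_map2 prod.swap" by (simp add: poly_map2_def poly2_fst poly2_snd)
  then have "poly_map2 (f \<circ> prod.swap)" using f(1) by (intro poly_map2_comp)
  moreover have "generic_fibre_card (f \<circ> prod.swap) 1"
    using f(2) by (intro generic_fibre_card_comp_bij) auto
  ultimately obtain A B where "coprime A B"
    and AB: "\<forall>z. bieval A ((f \<circ> prod.swap) z) = fst z * bieval B ((f \<circ> prod.swap) z)"
    using generically_injective_imp_fst_reduced_fraction by blast
  moreover have "bieval A (f z) = snd z * bieval B (f z)" for z
    using AB[rule_format, of "prod.swap z"] by simp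
  ultimately show ?thesis by blast
qed

subsection \<open>Zero sets in the plane\<close>

lemma slice_eq_0_imp_dvd:
  fixes F :: "'a::idom poly poly"
  assumes "slice a F = 0"
  shows "[:[:- a, 1:]:] dvd F"
proof -
  have "poly (coeff F j) a = 0" for j using assms by (metis coeff_slice coeff_0)
  then show ?thesis by (simp add: const_poly_dvd_iff poly_eq_0_iff_dvd)
qed

lemma finite_common_zeros_on_vertical_line:
  fixes A B :: "complex poly poly"
  assumes "coprime A B"
  shows "finite {b. bieval A (a, b) = 0 \<and> bieval B (a, b) = 0}"
proof (rule ccontr)
  assume infinite: "\<not> ?thesis"
  have "[:[:- a, 1:]:] dvd F" if "F \<in> {A, B}" for F
  proof (intro slice_eq_0_imp_dvd slice_eq_0_of_infinite_zeros)
    show "infinite {b. bieval F (a, b) = 0}"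
      using that infinite_super[OF _ infinite, of "{b. bieval F (a, b) = 0}"] by auto
  qed
  then have "[:[:- a, 1:]:] dvd (1 :: complex poly poly)"
    using assms by (intro coprime_common_divisor[of A B]) auto
  then show False by (simp add: is_unit_const_poly_iff is_unit_iff_degree)
qed

lemma finite_common_zeros_of_coprime:
  fixes A B :: "complex poly poly"
  assumes "coprime A B"
  shows "finite {q. bieval A q = 0 \<and> bieval B q = 0}"
proof (cases "A = 0")
  case True
  then have "B dvd 1" using assms by simp
  then have "bieval B q dvd 1" for q by (rule bieval.hom_dvd_1)
  then show ?thesis by (simp add: dvd_field_iff)
next
  case False
  define R where "R = eliminant A B"
  have "R \<noteq> 0" using assms by (simp add: R_def eliminant_eq_0_iff coprime_iff_gcd_eq_1)
  have "poly R a = 0 \<or> poly (lead_coeff A) a = 0" if "bieval A (a, b) = 0" "bieval B (a, b) = 0" for a b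
    using eliminant_eq_0_iff_common_root[OF poly_hom.comm_ring_hom_axioms, of A a B] that
    by (auto simp: R_def bieval_def slice_def)
  then have "{q. bieval A q = 0 \<and> bieval B q = 0} \<subseteq>
      (SIGMA a:{a. poly R a = 0} \<union> {a. poly (lead_coeff A) a = 0}.
        {b. bieval A (a, b) = 0 \<and> bieval B (a, b) = 0})"
    by auto
  moreover have "finite \<dots>"
    using \<open>R \<noteq> 0\<close> False assms
    by (intro finite_SigmaI finite_UnI poly_roots_finite finite_common_zeros_on_vertical_line) auto
  ultimately show ?thesis by (rule finite_subset)
qed

lemma uniform_limit_slices:
  fixes F :: "'a::topological_space \<times> 'b::topological_space \<Rightarrow> 'c::metric_space"
  assumes "continuous_on (UNIV \<times> K) F" "compact K"
  shows "uniform_limit K (\<lambda>a b. F (a, b)) (\<lambda>b. F (a0, b)) (at a0)"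
proof (rule uniform_limitI)
  fix e :: real assume "e > 0"
  then have "e / 2 > 0" by simp
  obtain V where V: "a0 \<in> V" "open V" "\<forall>a\<in>V \<inter> UNIV. \<forall>b\<in>K. dist (F (a, b)) (F (a0, b)) \<le> e / 2"
    by (rule continuous_on_prod_compactE[OF assms UNIV_I \<open>e / 2 > 0\<close>])
  have "\<forall>\<^sub>F a in at a0. a \<in> V" using V(1,2) by (intro eventually_at_in_open')
  then show "\<forall>\<^sub>F a in at a0. \<forall>b\<in>K. dist (F (a, b)) (F (a0, b)) < e"
  proof eventually_elim
    case (elim a)
    show ?case
    proof
      fix b assume "b \<in> K"
      then have "dist (F (a, b)) (F (a0, b)) \<le> e / 2" using V(3) elim by blast
      then show "dist (F (a, b)) (F (a0, b)) < e" using \<open>e > 0\<close> by simp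
    qed
  qed
qed

lemma eventually_bieval_zero_on_vertical_line:
  fixes F :: "complex poly poly"
  assumes "bieval F (a0, b0) = 0" "bieval F (a0, b1) \<noteq> 0" "r > 0"
  shows "\<forall>\<^sub>F a in at a0. \<exists>b\<in>ball b0 r. bieval F (a, b) = 0"
proof (rule ccontr)
  assume "\<not> ?thesis"
  then have "a0 islimpt {a. \<forall>b\<in>ball b0 r. bieval F (a, b) \<noteq> 0}" by (simp add: islimpt_iff_eventually)
  then obtain a where a: "\<And>n b. b \<in> ball b0 r \<Longrightarrow> bieval F (a n, b) \<noteq> 0" "\<And>n. a n \<noteq> a0" "a \<longlonglongrightarrow> a0"
    unfolding islimpt_sequential by blast
  have "bieval F (a0, b0) \<noteq> 0"
  proof (rule Hurwitz_no_zeros[of "ball b0 r" "\<lambda>n b. bieval F (a n, b)" "\<lambda>b. bieval F (a0, b)"])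
    show "uniform_limit K (\<lambda>n b. bieval F (a n, b)) (\<lambda>b. bieval F (a0, b)) sequentially"
      if "compact K" for K
    proof (rule filterlim_compose[OF uniform_limit_slices])
      show "filterlim a (at a0) sequentially" using a(2,3) by (simp add: filterlim_at)
    qed (use that in \<open>auto intro: continuous_on_poly2 poly2_bieval\<close>)
    show "\<not> (\<lambda>b. bieval F (a0, b)) constant_on ball b0 r"
    proof
      assume "(\<lambda>b. bieval F (a0, b)) constant_on ball b0 r"
      then have "bieval F (a0, b) = bieval F (a0, b0)" if "b \<in> ball b0 r" for b
        using that assms(3) unfolding constant_on_def by (metis centre_in_ball)
      then have "ball b0 r \<subseteq> {b. bieval F (a0, b) = 0}" using assms(1) by auto
      moreover have "infinite (ball b0 r)"
        using assms(3) by (intro uncountable_infinite uncountable_ball) simp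
      ultimately have "infinite {b. bieval F (a0, b) = 0}" by (rule infinite_super)
      then show False using assms(2) slice_eq_0_of_infinite_zeros[of F a0] by (simp add: bieval_def)
    qed
  qed (use assms(3) a(1) in \<open>auto simp: bieval_def intro!: holomorphic_intros\<close>)
  then show False using assms(1) by simp
qed

lemma bieval_zero_islimpt_zeros:
  fixes F :: "complex poly poly"
  assumes "bieval F p = 0"
  shows "p islimpt {q. bieval F q = 0}"
  unfolding islimpt_approachable
proof (intro allI impI)
  fix e :: real assume "e > 0"
  show "\<exists>q\<in>{q. bieval F q = 0}. q \<noteq> p \<and> dist q p < e"
  proof (cases "\<forall>b. bieval F (fst p, b) = 0")
    case True
    have "(fst p, snd p + of_real (e / 2)) \<noteq> p \<and> dist (fst p, snd p + of_real (e / 2)) p < e"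
      using \<open>e > 0\<close> by (auto simp: prod_eq_iff dist_prod_def dist_norm)
    then show ?thesis using True by blast
  next
    case False
    then obtain b1 where "bieval F (fst p, b1) \<noteq> 0" by blast
    then have "\<forall>\<^sub>F a in at (fst p). \<exists>b\<in>ball (snd p) (e / 2). bieval F (a, b) = 0"
      using assms \<open>e > 0\<close> by (intro eventually_bieval_zero_on_vertical_line) auto
    moreover have "\<forall>\<^sub>F a in at (fst p). a \<in> ball (fst p) (e / 2)"
      using \<open>e > 0\<close> by (intro eventually_at_in_open') auto
    moreover have "\<forall>\<^sub>F a in at (fst p). a \<noteq> fst p" by (rule eventually_neq_at_within)
    ultimately have "\<forall>\<^sub>F a in at (fst p). a \<noteq> fst p \<and> a \<in> ball (fst p) (e / 2) \<and>
        (\<exists>b\<in>ball (snd p) (e / 2). bieval F (a, b) = 0)"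
      by eventually_elim blast
    then obtain a b where ab: "a \<noteq> fst p" "a \<in> ball (fst p) (e / 2)" "b \<in> ball (snd p) (e / 2)"
      "bieval F (a, b) = 0"
      using eventually_happens'[OF at_neq_bot] by blast
    have "dist (a, b) p < e"
      using dist_le_dist_fst_plus_dist_snd[of "(a, b)" p] ab(2,3) by (simp add: dist_commute)
    then show ?thesis using ab(1,4) by (intro bexI[of _ "(a, b)"]) (auto simp: prod_eq_iff)
  qed
qed

subsection \<open>The complement of the image of a generically injective map\<close>

lemma isolated_point_not_zero_of_denominator:
  fixes A B :: "complex poly poly"
  assumes "coprime A B" "\<forall>z. bieval A (f z) = X z * bieval B (f z)"
    and "isolated_point_of p (UNIV - range f)"
  shows "bieval B p \<noteq> 0"
proof
  assume "bieval B p = 0"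
  obtain e where e: "e > 0" "ball p e \<inter> (UNIV - range f) = {p}"
    using assms(3) unfolding isolated_point_of_def by blast
  have "{q. bieval B q = 0} \<inter> ball p e \<subseteq> insert p {q. bieval A q = 0 \<and> bieval B q = 0}"
  proof
    fix q assume q: "q \<in> {q. bieval B q = 0} \<inter> ball p e"
    show "q \<in> insert p {q. bieval A q = 0 \<and> bieval B q = 0}"
    proof (cases "q = p")
      case False
      then obtain z where "q = f z" using q e(2) by blast
      then show ?thesis using q assms(2) by auto
    qed simp
  qed
  then have "finite ({q. bieval B q = 0} \<inter> ball p e)"
    by (rule finite_subset) (simp add: finite_common_zeros_of_coprime[OF assms(1)])
  then show False
    using bieval_zero_islimpt_zeros[OF \<open>bieval B p = 0\<close>] e(1) by (simp add: islimpt_eq_infinite_ball)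
qed

lemma generically_injective_imp_not_isolated_point:
  assumes f: "poly_map2 f" "generic_fibre_card f 1"
  shows "\<not> isolated_point_of p (UNIV - range f)"
proof
  assume isolated: "isolated_point_of p (UNIV - range f)"
  obtain A1 B1 where coprime1: "coprime A1 B1" and x: "\<forall>z. bieval A1 (f z) = fst z * bieval B1 (f z)"
    using generically_injective_imp_fst_reduced_fraction[OF f] by blast
  obtain A2 B2 where coprime2: "coprime A2 B2" and y: "\<forall>z. bieval A2 (f z) = snd z * bieval B2 (f z)"
    using generically_injective_imp_snd_reduced_fraction[OF f] by blast
  have B: "bieval B1 p \<noteq> 0" "bieval B2 p \<noteq> 0"
    using isolated_point_not_zero_of_denominator[OF coprime1 x isolated]
      isolated_point_not_zero_of_denominator[OF coprime2 y isolated] by auto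
  define h where "h q = (bieval A1 q / bieval B1 q, bieval A2 q / bieval B2 q)" for q
  have "isCont h p" unfolding h_def
    using B by (intro continuous_intros isCont_poly2 poly2_bieval)
  then have "isCont (\<lambda>q. f (h q)) p" using isCont_poly_map2[OF f(1)] by (rule isCont_o2)
  have "p \<in> closure (range f)"
    using generic_fibre_card_imp_dominant[OF f(2)] by (simp add: dominant_def)
  then obtain u where u: "\<And>n. u n \<in> range f" "u \<longlonglongrightarrow> p" unfolding closure_sequential by blast
  have "\<forall>\<^sub>F n in sequentially. bieval B1 (u n) \<noteq> 0 \<and> bieval B2 (u n) \<noteq> 0"
    using B isCont_tendsto_compose[OF isCont_poly2[OF poly2_bieval] u(2)]
    by (intro eventually_conj tendsto_imp_eventually_ne) blast+
  then have "\<forall>\<^sub>F n in sequentially. f (h (u n)) = u n"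
  proof eventually_elim
    case (elim n)
    obtain z where z: "u n = f z" using u(1)[of n] by blast
    have "h (u n) = z"
      using elim x[rule_format, of z] y[rule_format, of z] by (simp add: h_def z prod_eq_iff)
    then show ?case using z by simp
  qed
  then have "(\<lambda>n. f (h (u n))) \<longlonglongrightarrow> p" using u(2) by (simp add: tendsto_cong)
  then have "f (h p) = p"
    using isCont_tendsto_compose[OF \<open>isCont (\<lambda>q. f (h q)) p\<close> u(2)] LIMSEQ_unique by blast
  then show False using isolated unfolding isolated_point_of_def by (metis DiffE rangeI)
qed

subsection \<open>A map omitting an isolated point\<close>

definition omitting_map :: "nat \<Rightarrow> complex \<times> complex \<Rightarrow> complex \<times> complex" where
  "omitting_map k z = (fst z * snd z - 1, fst z + (fst z * snd z - 1) * snd z ^ k)"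

text \<open>On the fibre over \<open>(a, b)\<close> one has \<open>y = (1 + a) / x\<close>; this is the resulting equation for \<open>x\<close>.\<close>

definition fibre_poly :: "nat \<Rightarrow> complex \<Rightarrow> complex \<Rightarrow> complex poly" where
  "fibre_poly k a b = monom 1 k * [:- b, 1:] + [:a * (1 + a) ^ k:]"

lemma poly_fibre_poly: "poly (fibre_poly k a b) x = x ^ k * (x - b) + a * (1 + a) ^ k"
  by (simp add: fibre_poly_def poly_monom algebra_simps)

lemma degree_fibre_poly: "degree (fibre_poly k a b) = k + 1"
proof -
  have "degree (monom 1 k * [:- b, 1:]) = degree (monom (1::complex) k) + degree [:- b, 1:]"
    by (rule degree_mult_eq) auto
  then have "degree (monom 1 k * [:- b, 1:]) = k + 1" by (simp add: degree_monom_eq del: mult_pCons_right)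
  then show ?thesis unfolding fibre_poly_def by (subst degree_add_eq_left) simp_all
qed

lemma omitting_map_eq_iff:
  assumes "k \<ge> 1" "a * (1 + a) \<noteq> 0"
  shows "omitting_map k (x, y) = (a, b) \<longleftrightarrow> poly (fibre_poly k a b) x = 0 \<and> y = (1 + a) / x"
proof (cases "x = 0")
  case True
  then show ?thesis using assms by (auto simp: omitting_map_def poly_fibre_poly power_0_left)
next
  case False
  have "x + a * y ^ k = b \<longleftrightarrow> poly (fibre_poly k a b) x = 0" if y: "y = (1 + a) / x"
  proof -
    have "x ^ k * y ^ k = (1 + a) ^ k" using False by (simp add: y power_divide)
    then have "poly (fibre_poly k a b) x = x ^ k * (x - b) + a * (x ^ k * y ^ k)"
      by (simp add: poly_fibre_poly)
    also have "\<dots> = x ^ k * (x + a * y ^ k - b)" by (simp only: algebra_simps)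
    finally show ?thesis using False by simp
  qed
  moreover have "x * y - 1 = a \<longleftrightarrow> y = (1 + a) / x" using False by (auto simp: field_simps)
  ultimately show ?thesis by (auto simp: omitting_map_def)
qed

lemma vimage_omitting_map:
  assumes "k \<ge> 1" "a * (1 + a) \<noteq> 0"
  shows "omitting_map k -` {(a, b)} = (\<lambda>x. (x, (1 + a) / x)) ` {x. poly (fibre_poly k a b) x = 0}"
  using omitting_map_eq_iff[OF assms] by auto

lemma in_range_omitting_map:
  assumes "k \<ge> 1" "a * (1 + a) \<noteq> 0"
  shows "(a, b) \<in> range (omitting_map k)"
proof -
  have "\<not> constant (poly (fibre_poly k a b))" by (simp add: constant_degree degree_fibre_poly)
  then obtain x where "poly (fibre_poly k a b) x = 0" using fundamental_theorem_of_algebra by blast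
  then have "omitting_map k (x, (1 + a) / x) = (a, b)" by (simp add: omitting_map_eq_iff[OF assms])
  then show ?thesis by (metis rangeI)
qed

text \<open>The discriminant of the fibre polynomial up to sign and a power of \<open>a (1 + a)\<^sup>k\<close>; it is found by
  inserting the nonzero critical point \<open>x = k b / (k + 1)\<close>.\<close>

definition fibre_discriminant :: "nat \<Rightarrow> complex \<Rightarrow> complex \<Rightarrow> complex" where
  "fibre_discriminant k a b = of_nat (k + 1) ^ (k + 1) * (a * (1 + a) ^ k) - of_nat k ^ k * b ^ (k + 1)"

lemma rsquarefree_fibre_poly:
  assumes "k \<ge> 1" "a * (1 + a) \<noteq> 0" "fibre_discriminant k a b \<noteq> 0"
  shows "rsquarefree (fibre_poly k a b)"
  unfolding rsquarefree_roots
proof (intro allI notI)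
  fix x assume x: "poly (fibre_poly k a b) x = 0 \<and> poly (pderiv (fibre_poly k a b)) x = 0"
  obtain m where m: "k = Suc m" using assms(1) by (cases k) auto
  have "x \<noteq> 0" using x assms(1,2) by (auto simp: poly_fibre_poly power_0_left)
  have "poly (pderiv (fibre_poly k a b)) x = x ^ m * (of_nat (k + 1) * x - of_nat k * b)"
    unfolding fibre_poly_def pderiv_add pderiv_mult poly_add poly_mult
    by (simp add: pderiv_monom poly_monom pderiv_pCons m algebra_simps)
  then have critical: "of_nat (k + 1) * x = of_nat k * b" using x \<open>x \<noteq> 0\<close> by simp
  define n :: complex where "n = of_nat (k + 1)"
  have "a * (1 + a) ^ k = x ^ k * (b - x)"
    using x by (simp add: poly_fibre_poly algebra_simps add_eq_0_iff)
  then have "n ^ (k + 1) * (a * (1 + a) ^ k) = (n * x) ^ k * (n * (b - x))"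
    by (simp add: power_mult_distrib mult_ac)
  also have "\<dots> = (n * x) ^ k * (n * b - n * x)" by (simp only: right_diff_distrib)
  also have "n * x = of_nat k * b" unfolding n_def by (rule critical)
  also have "n * b - of_nat k * b = b" by (simp add: n_def algebra_simps)
  also have "(of_nat k * b) ^ k * b = of_nat k ^ k * b ^ (k + 1)" by (simp add: power_mult_distrib)
  finally show False using assms(3) unfolding n_def fibre_discriminant_def by simp
qed

lemma poly_map2_omitting_map: "poly_map2 (omitting_map k)"
  unfolding poly_map2_def omitting_map_def fst_conv snd_conv by (intro conjI poly2_intros)

lemma generic_fibre_card_omitting_map:
  assumes "k \<ge> 1"
  shows "generic_fibre_card (omitting_map k) (k + 1)"
proof -
  define g :: "complex \<times> complex \<Rightarrow> complex" where
    "g q = (fst q * (1 + fst q)) * fibre_discriminant k (fst q) (snd q)" for q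
  have "poly2 g" unfolding g_def fibre_discriminant_def by (intro poly2_intros)
  moreover have "g (1, 0) \<noteq> 0" by (simp add: g_def fibre_discriminant_def del: of_nat_Suc)
  moreover have "finite (omitting_map k -` {q}) \<and> card (omitting_map k -` {q}) = k + 1" if "g q \<noteq> 0" for q
  proof -
    obtain a b where q: "q = (a, b)" by force
    have nonzero: "a * (1 + a) \<noteq> 0" and squarefree: "rsquarefree (fibre_poly k a b)"
      using that assms by (auto simp: g_def q intro!: rsquarefree_fibre_poly)
    have "finite {x. poly (fibre_poly k a b) x = 0}"
      using squarefree by (intro poly_roots_finite) (auto simp: rsquarefree_def)
    moreover have "card ((\<lambda>x. (x, (1 + a) / x)) ` {x. poly (fibre_poly k a b) x = 0}) = k + 1"
      using squarefree rsquarefree_card_degree[of "fibre_poly k a b"]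
      by (subst card_image) (auto simp: inj_on_def degree_fibre_poly rsquarefree_def)
    ultimately show ?thesis unfolding q vimage_omitting_map[OF assms nonzero] by simp
  qed
  ultimately show ?thesis unfolding generic_fibre_card_def by blast
qed

lemma isolated_point_omitting_map:
  assumes "k \<ge> 1"
  shows "isolated_point_of (0, 0) (UNIV - range (omitting_map k))"
proof -
  have "omitting_map k z \<noteq> (0, 0)" for z by (auto simp: omitting_map_def)
  then have "(0, 0) \<notin> range (omitting_map k)" by (metis rangeE)
  moreover have "q \<in> range (omitting_map k)" if q: "q \<in> ball (0, 0) 1" "q \<noteq> (0, 0)" for q
  proof -
    obtain a b where ab: "q = (a, b)" by force
    have "norm a \<le> norm (a, b)" using norm_fst_le by blast
    also have "\<dots> < 1" using q(1) by (simp add: ab zero_prod_def[symmetric])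
    finally have "1 + a \<noteq> 0"
      by (metis add.inverse_inverse add_eq_0_iff less_irrefl norm_minus_cancel norm_one)
    show ?thesis
    proof (cases "a = 0")
      case True
      then have "b \<noteq> 0" using q ab by auto
      then have "omitting_map k (b, 1 / b) = q" by (simp add: omitting_map_def ab True)
      then show ?thesis by (metis rangeI)
    next
      case False
      then show ?thesis using in_range_omitting_map[OF assms, of a b] \<open>1 + a \<noteq> 0\<close> by (simp add: ab)
    qed
  qed
  ultimately show ?thesis unfolding isolated_point_of_def
    by (intro conjI exI[of _ 1]) auto
qed

theorem theorem1p5:
  fixes k :: nat
  shows "(\<exists>f. poly_map2 f \<and> dominant f \<and> generic_fibre_card f (k + 1) \<and>
            (\<exists>p. isolated_point_of p (UNIV - range f)))
         \<longleftrightarrow> k \<ge> 1"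
proof
  assume "\<exists>f. poly_map2 f \<and> dominant f \<and> generic_fibre_card f (k + 1) \<and>
            (\<exists>p. isolated_point_of p (UNIV - range f))"
  then show "k \<ge> 1"
    using generically_injective_imp_not_isolated_point by (cases k) auto
next
  assume "k \<ge> 1"
  then have generic: "generic_fibre_card (omitting_map k) (k + 1)"
    by (rule generic_fibre_card_omitting_map)
  then have "dominant (omitting_map k)" by (rule generic_fibre_card_imp_dominant) simp
  then show "\<exists>f. poly_map2 f \<and> dominant f \<and> generic_fibre_card f (k + 1) \<and>
            (\<exists>p. isolated_point_of p (UNIV - range f))"
    using poly_map2_omitting_map generic isolated_point_omitting_map[OF \<open>k \<ge> 1\<close>] by blast
qed

end
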